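(* Let $T\subset\mathbb{R}^2$ be a lattice-free triangle of Type 1 or Type 2 in canonical form with parameters $\eta,\mu$, let $f=(f_i,f_\ell)\in\mathbb{Q}^2\setminus\mathbb{Z}^2$ be a point in the interior of $T$, and let $r^j=(r^j_i,r^j_\ell)\in\mathbb{Q}^2\setminus\{0\}$. For $m_1\in\mathbb{Z}_+$ and $m_2\in\mathbb{Z}$ define $$ \Psi^j(m_1, m_2) = \max \left\{ \frac{\eta \left( r^j_{i} + m_1\right) + r^j_{\ell} - m_2}{1 - f_\ell - \eta f_i},\; \frac{\mu \left( r^j_{i} + m_1 \right) + m_2 - r^j_{\ell}}{f_\ell - \mu f_i} \right\}. $$ Then $$ \min_{(m_1,m_2) \in \mathbb{Z}_+ \times \mathbb{Z}} \Psi^j(m_1, m_2) = \min \left\{ \frac{\eta r^j_{i} + r^j_{\ell} - \lfloor \overline m^j_2 \rfloor }{1 - f_\ell - \eta f_i},\; \frac{\mu r^j_{i} + \lceil \overline m^j_2 \rceil - r^j_{\ell}}{f_\ell - \mu f_i} \right\}, $$ where $$ \overline m^j_2 = r^j_{\ell} + \frac{r^j_{i}\left( - \mu + \left(\mu + \eta \right) f_\ell \right)}{1 - \left(\mu + \eta \right) f_i}. $$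
   Context: Points of the plane are written $(x_i,x_\ell)$ (first coordinate $x_i$, second coordinate $x_\ell$); $\mathbb{Z}_+$ denotes the nonnegative integers. A convex set in $\mathbb{R}^2$ is lattice-free if it has no integral point in its interior (integral points on the boundary are allowed). A Type 1 triangle is a maximal lattice-free triangle with integral vertices and exactly one integral point in the relative interior of each edge. A Type 2 triangle is a maximal lattice-free triangle with at least one fractional vertex $v$, exactly one integral point in the relative interior of each of the two edges incident to $v$, and at least two integral points on the third edge. A Type 1 or Type 2 triangle $T$ with vertices $p^1,p^2,p^3$ is in canonical form with parameters $\eta,\mu\in\mathbb{R}$ if $p^2=(-1,1+\eta)$, $p^3=(-1,-\mu)$, $0\le\eta\le\mu\le\eta+1$, and the points $(0,0)$ and $(0,1)$ are respectively in the relative interior of the edge $p^3p^1$ and of the edge $p^2p^1$. The interior of such a $T$ is the set of $(x_i,x_\ell)$ with $-x_i<1$, $\eta x_i+x_\ell<1$ and $\mu x_i-x_\ell<0$. *)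

theory Defs
  imports "HOL-Analysis.Analysis"
begin

text \<open>Points of the plane are pairs: the first component is the coordinate $x_i$, the second is
  $x_\ell$.\<close>

abbreviation integral_points :: "(real \<times> real) set" where
  "integral_points \<equiv> \<int> \<times> \<int>"

definition lattice_free :: "(real \<times> real) set \<Rightarrow> bool" where
  "lattice_free K \<longleftrightarrow> convex K \<and> interior K \<inter> integral_points = {}"

text \<open>Maximality is with respect to inclusion among all lattice-free convex sets, not only among
  triangles.\<close>

definition maximal_lattice_free :: "(real \<times> real) set \<Rightarrow> bool" where
  "maximal_lattice_free K \<longleftrightarrow>
     lattice_free K \<and> (\<forall>L. lattice_free L \<and> K \<subseteq> L \<longrightarrow> L = K)"

definition is_triangle ::
  "(real \<times> real) set \<Rightarrow> real \<times> real \<Rightarrow> real \<times> real \<Rightarrow> real \<times> real \<Rightarrow> bool" where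
  "is_triangle T p q s \<longleftrightarrow> \<not> collinear {p, q, s} \<and> T = convex hull {p, q, s}"

definition one_integral_point_inside_edge :: "real \<times> real \<Rightarrow> real \<times> real \<Rightarrow> bool" where
  "one_integral_point_inside_edge p q \<longleftrightarrow>
     (\<exists>!z. z \<in> integral_points \<and> z \<in> rel_interior (closed_segment p q))"

definition type1_triangle :: "(real \<times> real) set \<Rightarrow> bool" where
  "type1_triangle T \<longleftrightarrow> maximal_lattice_free T \<and>
     (\<exists>p q s. is_triangle T p q s \<and> {p, q, s} \<subseteq> integral_points \<and>
        one_integral_point_inside_edge p q \<and>
        one_integral_point_inside_edge q s \<and>
        one_integral_point_inside_edge s p)"

text \<open>A fractional vertex is one that is not integral. The end points of the third edge count as
  points on that edge.\<close>

definition type2_triangle :: "(real \<times> real) set \<Rightarrow> bool" where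
  "type2_triangle T \<longleftrightarrow> maximal_lattice_free T \<and>
     (\<exists>v p q. is_triangle T v p q \<and> v \<notin> integral_points \<and>
        one_integral_point_inside_edge v p \<and>
        one_integral_point_inside_edge v q \<and>
        (\<exists>z w. z \<noteq> w \<and> z \<in> integral_points \<and> w \<in> integral_points \<and>
           z \<in> closed_segment p q \<and> w \<in> closed_segment p q))"

definition canonical_form :: "(real \<times> real) set \<Rightarrow> real \<Rightarrow> real \<Rightarrow> bool" where
  "canonical_form T \<eta> \<mu> \<longleftrightarrow>
     (\<exists>p1 p2 p3. is_triangle T p1 p2 p3 \<and>
        p2 = (- 1, 1 + \<eta>) \<and> p3 = (- 1, - \<mu>) \<and>
        0 \<le> \<eta> \<and> \<eta> \<le> \<mu> \<and> \<mu> \<le> \<eta> + 1 \<and>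
        (0, 0) \<in> rel_interior (closed_segment p3 p1) \<and>
        (0, 1) \<in> rel_interior (closed_segment p2 p1))"

definition Psi :: "real \<Rightarrow> real \<Rightarrow> real \<times> real \<Rightarrow> real \<times> real \<Rightarrow> nat \<Rightarrow> int \<Rightarrow> real" where
  "Psi \<eta> \<mu> f r m1 m2 =
     (case (f, r) of ((fi, fl), (ri, rl)) \<Rightarrow>
        max ((\<eta> * (ri + real m1) + rl - real_of_int m2) / (1 - fl - \<eta> * fi))
            ((\<mu> * (ri + real m1) + real_of_int m2 - rl) / (fl - \<mu> * fi)))"

definition mbar2 :: "real \<Rightarrow> real \<Rightarrow> real \<times> real \<Rightarrow> real \<times> real \<Rightarrow> real" where
  "mbar2 \<eta> \<mu> f r =
     (case (f, r) of ((fi, fl), (ri, rl)) \<Rightarrow>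
        rl + ri * (- \<mu> + (\<mu> + \<eta>) * fl) / (1 - (\<mu> + \<eta>) * fi))"

text \<open>The sets minimised over here are infinite, where \<^const>\<open>Min\<close> is unspecified and
  \<^const>\<open>Inf\<close> would not say that the minimum is attained.\<close>

definition is_minimum_of :: "real \<Rightarrow> real set \<Rightarrow> bool" where
  "is_minimum_of x S \<longleftrightarrow> x \<in> S \<and> (\<forall>y\<in>S. x \<le> y)"

end

(* Both terms of Psi are nondecreasing in m1, since eta and mu are nonnegative and the denominators
   are positive in the interior of T; hence m1 = 0 is optimal. For m1 = 0 the first term decreases
   and the second increases in m2, and they cross exactly at mbar2, so one of the two integers
   next to mbar2 is optimal. *)

theory Submission
  imports Defs
begin

text \<open>A closed half-space is convex, so it contains the hull of any set of its points; the
  interior of the hull then lies in the open half-space. This turns bounds checked at the vertices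
  of \<open>T\<close> into strict bounds at \<open>f\<close>.\<close>

lemma interior_convex_hull_subset_halfspace_lt:
  fixes a :: "'a::euclidean_space"
  assumes "a \<noteq> 0" and "\<And>x. x \<in> S \<Longrightarrow> a \<bullet> x \<le> b" and "x \<in> interior (convex hull S)"
  shows "a \<bullet> x < b"
proof -
  have "convex hull S \<subseteq> {x. a \<bullet> x \<le> b}"
    using assms(2) by (intro hull_minimal convex_halfspace_le) auto
  then have "x \<in> interior {x. a \<bullet> x \<le> b}"
    using assms(3) interior_mono by blast
  then show ?thesis
    using interior_halfspace_le[OF assms(1)] by auto
qed

text \<open>A line meeting a segment at \<open>x\<close> and at a second point \<open>z\<close>
  contains the whole segment. It locates the vertex \<open>p1\<close>, which the canonical form
  describes only through lattice points on its two edges.\<close>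

lemma closed_segment_hyperplane_endpoint:
  fixes a :: "'a::real_inner"
  assumes "z \<in> closed_segment x y" and "z \<noteq> x" and "a \<bullet> x = b" and "a \<bullet> z = b"
  shows "a \<bullet> y = b"
proof -
  obtain u where u: "z = (1 - u) *\<^sub>R x + u *\<^sub>R y"
    using assms(1) by (auto simp: in_segment)
  then have "u \<noteq> 0"
    using assms(2) by auto
  moreover have "u * (a \<bullet> y) = u * b"
    using assms(3,4) u by (simp add: inner_add_right algebra_simps)
  ultimately show ?thesis
    by simp
qed

lemma canonical_form_interior:
  assumes "canonical_form T \<eta> \<mu>" and "(x, y) \<in> interior T"
  shows "\<eta> * x + y < 1" and "\<mu> * x < y" and "0 \<le> \<eta>" and "0 \<le> \<mu>"
proof -
  obtain p1 where "is_triangle T p1 (- 1, 1 + \<eta>) (- 1, - \<mu>)"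
    and par: "0 \<le> \<eta>" "\<eta> \<le> \<mu>"
    and rel: "(0, 0) \<in> rel_interior (closed_segment (- 1, - \<mu>) p1)"
      "(0, 1) \<in> rel_interior (closed_segment (- 1, 1 + \<eta>) p1)"
    using assms(1) unfolding canonical_form_def by metis
  then have T: "T = convex hull {p1, (- 1, 1 + \<eta>), (- 1, - \<mu>)}"
    by (simp add: is_triangle_def)
  have s3: "(0, 0) \<in> closed_segment (- 1, - \<mu>) p1"
    using subsetD[OF rel_interior_subset rel(1)] .
  have s2: "(0, 1) \<in> closed_segment (- 1, 1 + \<eta>) p1"
    using subsetD[OF rel_interior_subset rel(2)] .
  have p1\<eta>: "(\<eta>, 1) \<bullet> p1 = 1"
    by (rule closed_segment_hyperplane_endpoint[OF s2]) auto
  have p1\<mu>: "(\<mu>, - 1) \<bullet> p1 = 0"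
    by (rule closed_segment_hyperplane_endpoint[OF s3]) auto
  \<comment> \<open>Two vertices give equality; at the third, (-1, -\<mu>), the value is -\<eta> -
    \<mu>, which is at most 0.\<close>
  have "(\<eta>, 1) \<bullet> (x, y) < 1"
    using assms(2) par p1\<eta> unfolding T
    by (intro interior_convex_hull_subset_halfspace_lt) (auto simp: zero_prod_def)
  then show "\<eta> * x + y < 1"
    by simp
  have "(\<mu>, - 1) \<bullet> (x, y) < 0"
    using assms(2) par p1\<mu> unfolding T
    by (intro interior_convex_hull_subset_halfspace_lt) (auto simp: zero_prod_def)
  then show "\<mu> * x < y"
    by simp
  show "0 \<le> \<eta>" "0 \<le> \<mu>"
    using par by auto
qed

text \<open>Up to \<open>c\<close> the maximum is \<open>A\<close>, which does not increase, so
  among the integers there the largest, the floor of \<open>c\<close>, is best. From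
  \<open>c\<close> on it is \<open>B\<close>, which does not decrease, so the ceiling is
  best.\<close>

lemma is_minimum_of_max_crossing:
  fixes A B :: "real \<Rightarrow> real"
  assumes "antimono A" and "mono B" and "A c = B c"
  shows "is_minimum_of (min (A \<lfloor>c\<rfloor>) (B \<lceil>c\<rceil>)) (range (\<lambda>m::int. max (A m) (B m)))"
proof -
  have below: "B x \<le> A x" if "x \<le> c" for x
    using antimonoD[OF assms(1) that] monoD[OF assms(2) that] assms(3) by linarith
  have above: "A x \<le> B x" if "c \<le> x" for x
    using antimonoD[OF assms(1) that] monoD[OF assms(2) that] assms(3) by linarith
  have "max (A \<lfloor>c\<rfloor>) (B \<lfloor>c\<rfloor>) = A \<lfloor>c\<rfloor>" "max (A \<lceil>c\<rceil>) (B \<lceil>c\<rceil>) = B \<lceil>c\<rceil>"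
    by (rule max_absorb1 max_absorb2, rule below above, simp)+
  then have "A \<lfloor>c\<rfloor> \<in> range (\<lambda>m::int. max (A m) (B m))" "B \<lceil>c\<rceil> \<in> range (\<lambda>m::int. max (A m) (B m))"
    by (auto intro: range_eqI[OF sym])
  then have "min (A \<lfloor>c\<rfloor>) (B \<lceil>c\<rceil>) \<in> range (\<lambda>m::int. max (A m) (B m))"
    unfolding min_def by presburger
  moreover have "min (A \<lfloor>c\<rfloor>) (B \<lceil>c\<rceil>) \<le> max (A m) (B m)" for m :: int
  proof (cases "real_of_int m \<le> c")
    case True
    then have "A \<lfloor>c\<rfloor> \<le> A m"
      by (intro antimonoD[OF assms(1)]) (simp add: le_floor_iff)
    then show ?thesis
      by simp
  next
    case False
    then have "B \<lceil>c\<rceil> \<le> B m"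
      by (intro monoD[OF assms(2)]) (simp add: ceiling_le_iff)
    then show ?thesis
      by simp
  qed
  ultimately show ?thesis
    unfolding is_minimum_of_def by blast
qed

text \<open>Cross-multiplying gives an equation linear in \<open>c - rl\<close>, whose coefficient
  is the sum of the two denominators; \<open>mbar2\<close> is its solution.\<close>

lemma mbar2_crossing:
  fixes \<eta> \<mu> fi fl ri rl :: real
  assumes "0 < 1 - fl - \<eta> * fi" and "0 < fl - \<mu> * fi"
  defines "c \<equiv> mbar2 \<eta> \<mu> (fi, fl) (ri, rl)"
  shows "(\<eta> * ri + rl - c) / (1 - fl - \<eta> * fi) = (\<mu> * ri + c - rl) / (fl - \<mu> * fi)"
proof -
  \<comment> \<open>This is the sum of the two positive denominators: \<open>fl\<close>
    cancels.\<close>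
  have "1 - (\<mu> + \<eta>) * fi \<noteq> 0"
    using assms(1,2) by (simp add: algebra_simps)
  then have "(c - rl) * (1 - (\<mu> + \<eta>) * fi) = ri * (- \<mu> + (\<mu> + \<eta>) * fl)"
    unfolding c_def mbar2_def by simp
  then have "(\<eta> * ri + rl - c) * (fl - \<mu> * fi) = (\<mu> * ri + c - rl) * (1 - fl - \<eta> * fi)"
    by algebra
  then show ?thesis
    using assms(1,2) by (simp add: frac_eq_eq)
qed

lemma Psi_mono_left:
  assumes "0 < 1 - fl - \<eta> * fi" and "0 < fl - \<mu> * fi" and "0 \<le> \<eta>" and "0 \<le> \<mu>" and "k \<le> m"
  shows "Psi \<eta> \<mu> (fi, fl) (ri, rl) k n \<le> Psi \<eta> \<mu> (fi, fl) (ri, rl) m n"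
proof -
  have "\<eta> * (ri + real k) \<le> \<eta> * (ri + real m)" "\<mu> * (ri + real k) \<le> \<mu> * (ri + real m)"
    using assms(3-5) by (auto intro: mult_left_mono)
  then show ?thesis
    using assms(1,2) unfolding Psi_def prod.case
    by (intro max.mono divide_right_mono) linarith+
qed

theorem proposition3p4:
  fixes T :: "(real \<times> real) set" and \<eta> \<mu> fi fl ri rl :: real
  assumes "type1_triangle T \<or> type2_triangle T"
    and "canonical_form T \<eta> \<mu>"
    and "(fi, fl) \<in> (\<rat> \<times> \<rat>) - (\<int> \<times> \<int>)"
    and "(fi, fl) \<in> interior T"
    and "(ri, rl) \<in> (\<rat> \<times> \<rat>) - {(0, 0)}"
  shows "is_minimum_of
    (min ((\<eta> * ri + rl - real_of_int \<lfloor>mbar2 \<eta> \<mu> (fi, fl) (ri, rl)\<rfloor>) / (1 - fl - \<eta> * fi))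
         ((\<mu> * ri + real_of_int \<lceil>mbar2 \<eta> \<mu> (fi, fl) (ri, rl)\<rceil> - rl) / (fl - \<mu> * fi)))
    {Psi \<eta> \<mu> (fi, fl) (ri, rl) m1 m2 | (m1 :: nat) (m2 :: int). True}"
proof -
  have a: "0 < 1 - fl - \<eta> * fi" and b: "0 < fl - \<mu> * fi" and nonneg: "0 \<le> \<eta>" "0 \<le> \<mu>"
    using canonical_form_interior[OF assms(2,4)] by simp_all
  define A where "A = (\<lambda>x. (\<eta> * ri + rl - x) / (1 - fl - \<eta> * fi))"
  define B where "B = (\<lambda>x. (\<mu> * ri + x - rl) / (fl - \<mu> * fi))"
  let ?c = "mbar2 \<eta> \<mu> (fi, fl) (ri, rl)"
  let ?Psi = "Psi \<eta> \<mu> (fi, fl) (ri, rl)"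
  have "antimono A" "mono B"
    unfolding A_def B_def using a b by (auto intro!: antimonoI monoI divide_right_mono)
  moreover have "A ?c = B ?c"
    unfolding A_def B_def by (rule mbar2_crossing[OF a b])
  ultimately have "is_minimum_of (min (A \<lfloor>?c\<rfloor>) (B \<lceil>?c\<rceil>)) (range (\<lambda>m::int. max (A m) (B m)))"
    by (rule is_minimum_of_max_crossing)
  also have "(\<lambda>m::int. max (A m) (B m)) = ?Psi 0"
    by (simp add: fun_eq_iff Psi_def A_def B_def)
  finally have attained: "min (A \<lfloor>?c\<rfloor>) (B \<lceil>?c\<rceil>) \<in> range (?Psi 0)"
    and least: "min (A \<lfloor>?c\<rfloor>) (B \<lceil>?c\<rceil>) \<le> ?Psi 0 n" for n
    unfolding is_minimum_of_def by blast+
  \<comment> \<open>The bound passes from the row \<open>m1 = 0\<close> to every row for the same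
    \<open>n\<close>; the minimizer already lies in that row.\<close>
  have "min (A \<lfloor>?c\<rfloor>) (B \<lceil>?c\<rceil>) \<le> ?Psi m n" for m n
    using least Psi_mono_left[OF a b nonneg le0] by (rule order_trans)
  then have "is_minimum_of (min (A \<lfloor>?c\<rfloor>) (B \<lceil>?c\<rceil>)) {?Psi m1 m2 | m1 m2. True}"
    using attained unfolding is_minimum_of_def by blast
  then show ?thesis
    unfolding A_def B_def .
qed

end
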